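(* Let $G=(V,\mathcal D,\ell_v)$ and $G'=(V',\mathcal D',\ell'_v)$ be finite node-labeled digraphs that are weakly connected, simple, oriented and transitively closed. If $(U,\phi)$ is a feasible solution with $\mathcal P(U,\phi)=\operatorname{DMCES}(G,G')$, then $(U,\phi)$ respects order on labels, i.e. there are no $u,v\in U$ with $\ell_v(u)=\ell_v(v)$, $(v,u)\in\mathcal D$ and $(\phi(u),\phi(v))\in\mathcal D'$.
   Context: A node-labeled digraph $G=(V,\mathcal D,\ell_v)$ consists of a finite node set $V$, directed edges $\mathcal D\subseteq V\times V$, and a node-labeling function $\ell_v$ on $V$. Weakly connected: underlying undirected graph connected. Simple: no self-loops and no parallel edges with the same source and target. Oriented: no pair $(a,b),(b,a)$ both in $\mathcal D$. Transitively closed: whenever $(a,b),(b,c)\in\mathcal D$ with $a\neq c$, also $(a,c)\in\mathcal D$. A feasible solution is a pair $(U,\phi)$ with $U\subseteq V$ and $\phi:U\to V'$ injective with $\ell'_v(\phi(x))=\ell_v(x)$ for all $x\in U$; its score is $\mathcal P(U,\phi)=|\{(v_1,v_2)\in U\times U:(v_1,v_2)\in\mathcal D,\ (\phi(v_1),\phi(v_2))\in\mathcal D'\}|$; $\operatorname{DMCES}(G,G')$ is the maximum score over all feasible solutions. *)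

theory Defs
  imports "Graph_Theory.Graph_Theory" "HOL-Library.FuncSet"
begin

text \<open>
  A node-labeled digraph is a \<^typ>\<open>'a pair_pre_digraph\<close> (whose arcs are a set of ordered pairs,
  so there are no parallel arcs) together with a labeling function. Labels of the two graphs
  being compared live in a common type. The locale \<^locale>\<open>pair_digraph\<close> says that the node set
  is finite, that the arcs are a subset of its square, and that there are no self-loops.
\<close>

definition weakly_connected :: "'a pair_pre_digraph \<Rightarrow> bool" where
  "weakly_connected G \<longleftrightarrow> Digraph_Component.connected (with_proj G)"

definition oriented :: "'a pair_pre_digraph \<Rightarrow> bool" where
  "oriented G \<longleftrightarrow> \<not> (\<exists>a b. (a, b) \<in> parcs G \<and> (b, a) \<in> parcs G)"

definition transitively_closed :: "'a pair_pre_digraph \<Rightarrow> bool" where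
  "transitively_closed G \<longleftrightarrow>
     (\<forall>a b c. (a, b) \<in> parcs G \<longrightarrow> (b, c) \<in> parcs G \<longrightarrow> a \<noteq> c \<longrightarrow> (a, c) \<in> parcs G)"

text \<open>
  A map \<open>U \<rightarrow> V'\<close> is represented by a total function of which only the values on \<open>U\<close> matter.
\<close>

definition feasible ::
  "'a pair_pre_digraph \<Rightarrow> ('a \<Rightarrow> 'l) \<Rightarrow> 'b pair_pre_digraph \<Rightarrow> ('b \<Rightarrow> 'l) \<Rightarrow>
   'a set \<Rightarrow> ('a \<Rightarrow> 'b) \<Rightarrow> bool" where
  "feasible G l G' l' U \<phi> \<longleftrightarrow>
     U \<subseteq> pverts G \<and> \<phi> \<in> U \<rightarrow> pverts G' \<and> inj_on \<phi> U \<and> (\<forall>x\<in>U. l' (\<phi> x) = l x)"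

definition score ::
  "'a pair_pre_digraph \<Rightarrow> 'b pair_pre_digraph \<Rightarrow> 'a set \<Rightarrow> ('a \<Rightarrow> 'b) \<Rightarrow> nat" where
  "score G G' U \<phi> =
     card {(v1, v2) \<in> U \<times> U. (v1, v2) \<in> parcs G \<and> (\<phi> v1, \<phi> v2) \<in> parcs G'}"

definition DMCES ::
  "'a pair_pre_digraph \<Rightarrow> ('a \<Rightarrow> 'l) \<Rightarrow> 'b pair_pre_digraph \<Rightarrow> ('b \<Rightarrow> 'l) \<Rightarrow> nat" where
  "DMCES G l G' l' = Max {score G G' U \<phi> | U \<phi>. feasible G l G' l' U \<phi>}"

definition respects_order_on_labels ::
  "'a pair_pre_digraph \<Rightarrow> ('a \<Rightarrow> 'l) \<Rightarrow> 'b pair_pre_digraph \<Rightarrow>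
   'a set \<Rightarrow> ('a \<Rightarrow> 'b) \<Rightarrow> bool" where
  "respects_order_on_labels G l G' U \<phi> \<longleftrightarrow>
     \<not> (\<exists>u\<in>U. \<exists>v\<in>U. l u = l v \<and> (v, u) \<in> parcs G \<and> (\<phi> u, \<phi> v) \<in> parcs G')"

text \<open>The maximum defining \<^const>\<open>DMCES\<close> is taken over a finite nonempty set.\<close>

lemma feasible_empty: "feasible G l G' l' {} \<phi>"
  by (simp add: feasible_def)

lemma scores_nonempty: "{score G G' U \<phi> | U \<phi>. feasible G l G' l' U \<phi>} \<noteq> {}"
  using feasible_empty by blast

lemma scores_finite:
  assumes "pair_digraph G"
  shows "finite {score G G' U \<phi> | U \<phi>. feasible G l G' l' U \<phi>}"
proof (rule finite_subset)
  have "finite (parcs G)"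
    using assms by (simp add: pair_digraph_def pair_fin_digraph_def pair_fin_digraph_axioms_def)
  then show "{score G G' U \<phi> | U \<phi>. feasible G l G' l' U \<phi>} \<subseteq> {..card (parcs G)}"
    by (auto simp: score_def intro!: card_mono)
qed simp

end

theory Submission
  imports Defs "HOL-Combinatorics.Transposition"
begin

text \<open>
  Both arc relations are strict partial orders. If \<open>v < u\<close> in \<open>G\<close> but \<open>\<phi> u < \<phi> v\<close> in \<open>G'\<close>,
  exchange the images of \<open>u\<close> and \<open>v\<close>. By transitivity, an arc \<open>(x, y)\<close> that is preserved before
  but not after the exchange has a partner, obtained by transposing \<open>u\<close> and \<open>v\<close> in it, that is
  preserved after but not before. The arc \<open>(v, u)\<close> is gained in addition, so the score strictly
  increases.
\<close>

lemma transitively_closedD: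
  assumes "transitively_closed G" "oriented G" "(a, b) \<in> parcs G" "(b, c) \<in> parcs G"
  shows "(a, c) \<in> parcs G"
  \<comment> \<open>If \<open>a = c\<close>, the two arcs would be opposite, so orientation
    discharges the side condition \<open>a \<noteq> c\<close>.\<close>
  using assms unfolding transitively_closed_def oriented_def by blast

lemma score_le_DMCES:
  assumes "pair_digraph G" "feasible G l G' l' U \<phi>"
  shows "score G G' U \<phi> \<le> DMCES G l G' l'"
  unfolding DMCES_def using assms by (intro Max_ge scores_finite) auto

text \<open>The transposition permutes \<open>U\<close>, which keeps injectivity, and moves only two
  nodes of equal label, which keeps the labels.\<close>

lemma feasible_comp_transpose:
  assumes "feasible G l G' l' U \<phi>" "u \<in> U" "v \<in> U" "l u = l v"
  shows "feasible G l G' l' U (\<phi> \<circ> transpose u v)"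
proof -
  have "transpose u v ` U = U"
    using assms(2,3) by simp
  moreover have "inj_on (transpose u v) U"
    by simp
  ultimately have "inj_on (\<phi> \<circ> transpose u v) U"
    using assms(1) by (simp add: comp_inj_on feasible_def)
  then show ?thesis
    using assms by (auto simp: feasible_def transpose_def)
qed

lemma score_less_comp_transpose:
  assumes fin: "finite (parcs G)"
    and G: "oriented G" "transitively_closed G"
    and G': "oriented G'" "transitively_closed G'"
    and U: "u \<in> U" "v \<in> U"
    and vu: "(v, u) \<in> parcs G" and uv': "(\<phi> u, \<phi> v) \<in> parcs G'"
  shows "score G G' U \<phi> < score G G' U (\<phi> \<circ> transpose u v)"
proof -
  let ?t = "transpose u v"
  define S where
    "S = {(x, y) \<in> U \<times> U. (x, y) \<in> parcs G \<and> (\<phi> x, \<phi> y) \<in> parcs G'}"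
  define T where
    "T = {(x, y) \<in> U \<times> U. (x, y) \<in> parcs G \<and> (\<phi> (?t x), \<phi> (?t y)) \<in> parcs G'}"
  have finS: "finite S" and finT: "finite T"
    by (rule finite_subset[OF _ fin], auto simp: S_def T_def)+
  note trans = transitively_closedD[OF G(2,1)]
  note trans' = transitively_closedD[OF G'(2,1)]
  have uv: "(u, v) \<notin> parcs G" and vu': "(\<phi> v, \<phi> u) \<notin> parcs G'"
    using G(1) G'(1) vu uv' unfolding oriented_def by blast+
  have tU: "?t x \<in> U" if "x \<in> U" for x
    using that U by (simp add: transpose_def)
  have gain: "(v, u) \<in> T - S"
    using U vu uv' vu' by (simp add: S_def T_def)
  \<comment> \<open>Leaving \<open>(v, u)\<close> out of the target makes the later comparison of
    cardinalities strict.\<close>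
  have image: "map_prod ?t ?t ` (S - T) \<subseteq> T - S - {(v, u)}"
  proof (rule image_subsetI)
    fix p assume p: "p \<in> S - T"
    obtain x y where [simp]: "p = (x, y)"
      by fastforce
    have xy: "x \<in> U" "y \<in> U" "(x, y) \<in> parcs G" "(\<phi> x, \<phi> y) \<in> parcs G'"
      "(\<phi> (?t x), \<phi> (?t y)) \<notin> parcs G'"
      using p by (auto simp: S_def T_def)
    have ne: "(x, y) \<noteq> (u, v)" "(x, y) \<noteq> (v, u)"
      using xy uv vu' by auto
    have "(?t x, ?t y) \<in> parcs G"
    proof -
      \<comment> \<open>If \<open>y = v\<close> or \<open>x = u\<close>, composing the arc with
        \<open>(v, u)\<close> in \<open>G\<close> gives the transposed arc. If \<open>y = u\<close>
        or \<open>x = v\<close>, composing the image arc with \<open>(\<phi> u, \<phi> v)\<close> in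
        \<open>G'\<close> shows that \<open>(x, y)\<close> is not lost, a contradiction. Otherwise
        \<open>?t\<close> fixes both ends.\<close>
      consider "y = v" | "x = u" | "y = u" | "x = v" | "x \<notin> {u, v}" "y \<notin> {u, v}"
        by blast
      then show ?thesis
      proof cases
        case 1
        \<comment> \<open>Orientation, taken with equal endpoints, also excludes loops.\<close>
        then have "x \<noteq> u" "x \<noteq> v"
          using xy(3) uv G(1) by (auto simp: oriented_def)
        then show ?thesis
          using 1 xy(3) vu trans by simp
      next
        case 2
        then have "y \<noteq> u" "y \<noteq> v"
          using xy(3) uv G(1) by (auto simp: oriented_def)
        then show ?thesis
          using 2 xy(3) vu trans by simp
      next
        case 3
        then have "x \<noteq> u" "x \<noteq> v"
          using xy(3) ne G(1) by (auto simp: oriented_def)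
        then show ?thesis
          using 3 xy(4,5) trans'[OF _ uv'] by simp
      next
        case 4
        then have "y \<noteq> u" "y \<noteq> v"
          using xy(3) ne G(1) by (auto simp: oriented_def)
        then show ?thesis
          using 4 xy(4,5) trans'[OF uv'] by simp
      qed (use xy in simp)
    qed
    moreover have "(?t x, ?t y) \<noteq> (v, u)"
      using ne(1) by (metis prod.inject transpose_apply_first transpose_apply_second
          transpose_involutory)
    \<comment> \<open>As \<open>?t\<close> is an involution, transposing swaps the two conditions on
      images that separate \<open>S\<close> from \<open>T\<close>.\<close>
    ultimately show "map_prod ?t ?t p \<in> T - S - {(v, u)}"
      using xy tU by (simp add: S_def T_def)
  qed
  have "inj_on (map_prod ?t ?t) (S - T)"
    by (rule inj_on_subset[OF prod.inj_map]) simp_all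
  then have "card (S - T) \<le> card (T - S - {(v, u)})"
    using image finT by (metis card_inj_on_le finite_Diff)
  also have "\<dots> < card (T - S)"
    using gain finT by (intro card_Diff1_less) simp_all
  \<comment> \<open>The common part of \<open>S\<close> and \<open>T\<close> cancels.\<close>
  finally have "card S < card T"
    using finS finT by (simp add: card_less_sym_Diff card_Diff_subset_Int card_mono
        Int_commute less_diff_iff)
  then show ?thesis
    by (simp add: score_def S_def T_def)
qed

theorem theorem8p4:
  fixes G :: "'a pair_pre_digraph" and l :: "'a \<Rightarrow> 'l"
    and G' :: "'b pair_pre_digraph" and l' :: "'b \<Rightarrow> 'l"
    and U :: "'a set" and \<phi> :: "'a \<Rightarrow> 'b"
  assumes "pair_digraph G" and "weakly_connected G"
    and "oriented G" and "transitively_closed G"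
    and "pair_digraph G'" and "weakly_connected G'"
    and "oriented G'" and "transitively_closed G'"
    and "feasible G l G' l' U \<phi>"
    and "score G G' U \<phi> = DMCES G l G' l'"
  shows "respects_order_on_labels G l G' U \<phi>"
proof (rule ccontr)
  assume "\<not> respects_order_on_labels G l G' U \<phi>"
  then obtain u v where uv: "u \<in> U" "v \<in> U" "l u = l v" "(v, u) \<in> parcs G"
      "(\<phi> u, \<phi> v) \<in> parcs G'"
    by (auto simp: respects_order_on_labels_def)
  have "finite (parcs G)"
    using assms(1) by (simp add: pair_digraph_def pair_fin_digraph_def pair_fin_digraph_axioms_def)
  then have "score G G' U \<phi> < score G G' U (\<phi> \<circ> transpose u v)"
    using assms uv by (intro score_less_comp_transpose)
  also have "\<dots> \<le> DMCES G l G' l'"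
    using assms uv by (intro score_le_DMCES feasible_comp_transpose)
  finally show False
    using assms(10) by simp
qed

end
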